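(* Let a partially ordered integration structure be given with Riesz spaces $X,Y,Z$, $\mathcal H$ a $\sigma$-algebra of subsets of $\Omega$, integrals in $Z$ taken with respect to $(D)$-convergence, and $Z$ $\sigma$-Dedekind complete and weakly $\sigma$-distributive. Let $\mu:\mathcal H\to Y^+$ be finitely additive and let $\{f_n\}_{n\in\mathbb N}$ be a sequence of functions $f_n:\Omega\to X$, net Riemann integrable with respect to $\mu$ on every set of $\mathcal H$. Suppose that: (a) the integration procedure satisfies the Henstock property; (b) either $\{f_n\}$ has uniformly regulated net Riemann integrals, or there is $z\in Z$ with $\big|\int_A f_n\,d\mu-\sum_{i\in I_\gamma}f_n(\tau_{\gamma_i})\mu(\sigma_{\gamma_i})\big|\le z$ for every $A\in\mathcal H$, $\gamma\in\Gamma(A)$ and $n\in\mathbb N$; (c) $\{f_n\}$ has uniformly approximable integrals; (d) $f_n$ converges to $f:\Omega\to X$ with a common regulator; (e) there is a bounded function $h:\Omega\to X$ with $|f_n|\le h$ pointwise for every $n\in\mathbb N$. Then $f$ is net Riemann integrable and, for $A\in\mathcal H$, $$\int_A f\,d\mu=(o)\text{-}\lim_{n\to\infty}\int_A f_n\,d\mu .$$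
   Context: A net convergence structure $\eta$ on a set $V$ assigns to each $v\in V$ a class of nets in $V$ ("converging to $v$") such that: (i) constant nets $v$ converge to $v$; (ii) every quasi-subnet of a net converging to $v$ converges to $v$, where $(y_j)_{j\in J}$ is a quasi-subnet of $(x_i)_{i\in I}$ if for every $i_0$ there is $j_0$ with $\{y_j:j\ge j_0\}\subseteq\{x_i:i\ge i_0\}$; (iii) if $(x_i)_{i\in I},(y_i)_{i\in I}$ converge to $v$ and $z_i\in\{x_i,y_i\}$ for all $i$, then $(z_i)$ converges to $v$. Standing assumptions: real vector spaces, Archimedean Riesz spaces, Hausdorff structures (unique limits), continuous addition and multiplication by fixed reals; on Riesz spaces the structure is locally solid: if $y_l\to0$ and $(x_i)$ is a net such that for every $l_0$ there is $i_0$ such that for every $i\ge i_0$ there is $l\ge l_0$ with $|x_i|\le|y_l|$, then $x_i\to 0$. A partially ordered integration structure consists of: a set $\Omega$ with a class $\mathcal H$ of subsets (here a $\sigma$-algebra); for each $A\in\mathcal H$ a net $\{(\sigma_\gamma,\tau_\gamma)\}_{\gamma\in\Gamma(A)}$, where $\Gamma(A)$ is a directed set and $\sigma_\gamma=\{\sigma_{\gamma_i}\}_{i\in I_\gamma}$, $\tau_\gamma=\{\tau_{\gamma_i}\}_{i\in I_\gamma}$ are finite families in $\mathcal H$ and $\Omega$ (the set $\sigma_{\gamma_i}$ is tagged by $\tau_{\gamma_i}$); Riesz spaces $(X,\eta_1),(Y,\eta_2),(Z,\eta_3)$ with net convergence structures; and a bilinear product $\bullet:X\times Y\to Z$ (juxtaposition),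 i.e. a bilinear map, continuous in each argument separately, isotone on $X^+\times Y^+$, with $\sup_n(x_n\bullet y)=(\sup_n x_n)\bullet y$ and $\sup_n(x\bullet y_n)=x\bullet(\sup_n y_n)$ for $x\in X^+$, $y\in Y^+$ and nonnegative sequences whose suprema exist. The net Riemann integral is $\int_A f\,d\mu=\lim_{\gamma\in\Gamma(A)}\sum_{i\in I_\gamma}f(\tau_{\gamma_i})\mu(\sigma_{\gamma_i})$ when the limit exists; $f$ is net Riemann integrable if this holds for every set in $\mathcal H$. Convention: the nets consist of sets such that $\sum_{i\in I_\gamma}\mu(\sigma_{\gamma_i})=\mu(\bigcup_{i\in I_\gamma}\sigma_{\gamma_i})$ for $\mu$ finitely additive. A $(D)$-sequence (regulator) is a double sequence $\{a_{ij}\}$ with $a_{ij}\ge a_{i,j+1}$ and $\bigwedge_j a_{ij}=0$ for all $i$. A net $(x_i)$ $(D)$-converges to $x$ if there is a $(D)$-sequence such that for every $\varphi\in\mathbb N^{\mathbb N}$ there is $i_0$ with $|x_i-x|\le\bigvee_{j}a_{j\varphi(j)}$ for $i\ge i_0$ (suprema understood to exist). $Z$ is weakly $\sigma$-distributive if $\bigwedge_{\varphi}\bigvee_i a_{i\varphi(i)}=0$ for every $(D)$-sequence; $\sigma$-Dedekind complete if every countable set bounded above has a supremum. $(o)$-$\lim z_n=z$ means $|z_n-z|\le w_n$ for some $w_n\downarrow0$. A function $h:\Omega\to X$ is bounded if $|h(\omega)|\le x$ for all $\omega$ and some $x\in X$. Common regulator: there is a $(D)$-sequence $\{a_{ij}\}$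 in $X$ such that for every $\varphi$ and $\omega\in\Omega$ there is $p(\omega)$ with $|f_n(\omega)-f(\omega)|\le\bigvee_i a_{i\varphi(i)}$ for $n\ge p(\omega)$. Uniformly regulated integrals: there is a nonnegative triple sequence $\{a_{nij}\}$ in $Z$ such that $\{a_{nij}\}_{ij}$ is bounded for every $n$ and $a_{nij}\downarrow0$ as $j\to\infty$; $\big\{\sum_{n=1}^m\bigvee_i a_{ni\varphi(i+n+1)}\big\}_{m}$ is bounded in $Z$ for every $\varphi\in\mathbb N^{\mathbb N}$; and for every $\varphi$, $n$ and $A\in\mathcal H$ there is $\gamma_n\in\Gamma(A)$ with $\big|\int_A f_n\,d\mu-\sum_{i\in I_\gamma}f_n(\tau_{\gamma_i})\mu(\sigma_{\gamma_i})\big|\le\bigvee_i a_{ni\varphi(i+n+1)}$ for each $\gamma\ge\gamma_n$. Uniformly approximable integrals: there is a $(D)$-sequence $\{b_{ij}\}$ in $Z$ such that for every $A\in\mathcal H$ and $\varphi$ there is $\gamma_0\in\Gamma(A)$ with $\big|\int_A f_n\,d\mu-\sum_{i\in I_\gamma}f_n(\tau_{\gamma_i})\mu(\sigma_{\gamma_i})\big|\le\bigvee_i b_{i\varphi(i)}$ for all $\gamma\ge\gamma_0$ and all $n$. Henstock property (for integrable $g$, here applied to each $f_n$): (H1) if $g$ is integrable on $B\in\mathcal H$ it is integrable on every $A\subseteq B$, $A\in\mathcal H$; (H2) the integral of $g$ is additive (even for non-disjoint sets) on the sets forming $\sigma_\gamma$, $\gamma\in\Gamma(B)$, for each $B$ on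 which $g$ is integrable; (H3) for such $B$ and $\gamma\in\Gamma(B)$, the sets of $\sigma_\gamma$ have union $B$; (H4) if $g$ is integrable on $B$ and $\{B_j\}_{j=1}^n$ are the sets of some $\gamma\in\Gamma(B)$, then for each $J\subseteq\{1,\dots,n\}$ and $\gamma^0\in\Gamma(\bigcup_{j\in J}B_j)$ there are $\gamma^*\ge\gamma^0$ in $\Gamma(\bigcup_{j\in J}B_j)$ and $\gamma^{(B)}\ge\gamma$ in $\Gamma(B)$ such that the tagged family of $\gamma^{(B)}$ is that of $\gamma^*$ together with the sets $B_k$, $k\notin J$, tagged as in $\gamma$. Alternatively, (H2) may be replaced by finite additivity of the integral and (H4) by: (H4') if $\{B_j\}_{j=1}^n$ are the sets of some $\gamma\in\Gamma(B)$, $J\subseteq\{1,\dots,n\}$ and $F=B\setminus\bigcup_{j\in J}B_j$, then given $\gamma_0^{(F)}\in\Gamma(F)$ and $\gamma_0^{(B)}\in\Gamma(B)$ in the integrability definitions of $g$ on $F$ and on $B$, there are $\gamma_{00}^{(F)}\in\Gamma(F)$ and $\gamma_{00}^{(B)}\ge\gamma_0^{(B)}$ in $\Gamma(B)$ such that the tagged family of $\gamma_{00}^{(B)}$ is that of $\gamma_{00}^{(F)}$ together with the tagged sets $B_j$, $j\in J$. *)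

theory Defs
  imports "HOL-Analysis.Analysis" "HOL-Library.Lattice_Algebras" "HOL-Library.Lub_Glb"
    "HOL-Library.Multiset"
begin

section \<open>Riesz spaces\<close>

class archimedean_riesz_space = ordered_real_vector + lattice_ab_group_add_abs +
  assumes archimedean: "0 \<le> x \<Longrightarrow> (\<And>n::nat. real n *\<^sub>R x \<le> y) \<Longrightarrow> x = 0"

text \<open>Riesz spaces need not be complete, so suprema and infima are handled relationally: a
  formula "the supremum of \<open>S\<close> is \<open>s\<close>" also asserts that this supremum exists.\<close>

abbreviation is_sup :: "'a::order set \<Rightarrow> 'a \<Rightarrow> bool" where
  "is_sup S s \<equiv> isLub UNIV S s"

abbreviation is_inf :: "'a::order set \<Rightarrow> 'a \<Rightarrow> bool" where
  "is_inf S s \<equiv> isGlb UNIV S s"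

definition decreases_to_zero :: "(nat \<Rightarrow> 'a::{order,zero}) \<Rightarrow> bool" where
  "decreases_to_zero w \<longleftrightarrow> decseq w \<and> is_inf (range w) 0"

text \<open>The empty set is excluded: it is bounded above but has no supremum in a nonzero Riesz
  space.\<close>

definition sigma_dedekind_complete :: "'z::order itself \<Rightarrow> bool" where
  "sigma_dedekind_complete _ \<longleftrightarrow>
    (\<forall>S::'z set. S \<noteq> {} \<and> countable S \<and> (\<exists>u. \<forall>x\<in>S. x \<le> u) \<longrightarrow> (\<exists>s. is_sup S s))"

definition D_sequence :: "(nat \<Rightarrow> nat \<Rightarrow> 'a::{order,zero}) \<Rightarrow> bool" where
  "D_sequence a \<longleftrightarrow> (\<forall>i. decreases_to_zero (a i))"

text \<open>As usual, the condition concerns those \<open>(D)\<close>-sequences for which the suprema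
  \<open>\<Or>\<^sub>i a\<^bsub>i\<phi>(i)\<^esub>\<close> exist; for instance \<open>i / j\<close> in \<open>\<real>\<close> is a
  \<open>(D)\<close>-sequence for which they do not.\<close>

definition weakly_sigma_distributive :: "'z::{order,zero} itself \<Rightarrow> bool" where
  "weakly_sigma_distributive _ \<longleftrightarrow>
    (\<forall>a::nat \<Rightarrow> nat \<Rightarrow> 'z. D_sequence a \<and> (\<forall>\<phi>. \<exists>s. is_sup (range (\<lambda>i. a i (\<phi> i))) s) \<longrightarrow>
      is_inf {s. \<exists>\<phi>. is_sup (range (\<lambda>i. a i (\<phi> i))) s} 0)"

definition o_limit :: "(nat \<Rightarrow> 'z::archimedean_riesz_space) \<Rightarrow> 'z \<Rightarrow> bool" where
  "o_limit z l \<longleftrightarrow> (\<exists>w. decreases_to_zero w \<and> (\<forall>n. \<bar>z n - l\<bar> \<le> w n))"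


section \<open>Nets and net convergence structures\<close>

record 'i index_set =
  elems :: "'i set"
  leq :: "'i \<Rightarrow> 'i \<Rightarrow> bool"

definition tail :: "'i index_set \<Rightarrow> 'i \<Rightarrow> 'i set" where
  "tail D i\<^sub>0 = {i \<in> elems D. leq D i\<^sub>0 i}"

definition directed_set :: "'i index_set \<Rightarrow> bool" where
  "directed_set D \<longleftrightarrow>
    elems D \<noteq> {} \<and>
    (\<forall>i\<in>elems D. leq D i i) \<and>
    (\<forall>i\<in>elems D. \<forall>j\<in>elems D. \<forall>k\<in>elems D. leq D i j \<and> leq D j k \<longrightarrow> leq D i k) \<and>
    (\<forall>i\<in>elems D. \<forall>j\<in>elems D. \<exists>k\<in>elems D. leq D i k \<and> leq D j k)"

text \<open>A net in \<open>'v\<close> is a directed set \<open>D\<close> together with a function \<open>'i \<Rightarrow> 'v\<close>, of which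
  only the values on \<open>elems D\<close> matter (by the quasi-subnet axiom below). The class of all nets is
  rendered by the nets whose index sets are subsets of an arbitrary type \<open>'i\<close>; each statement is
  about every such type, and so about index sets of every size.\<close>

type_synonym ('i, 'v) net_convergence = "'i index_set \<Rightarrow> ('i \<Rightarrow> 'v) \<Rightarrow> 'v \<Rightarrow> bool"

definition quasi_subnet ::
  "'i index_set \<Rightarrow> ('i \<Rightarrow> 'v) \<Rightarrow> 'i index_set \<Rightarrow> ('i \<Rightarrow> 'v) \<Rightarrow> bool" where
  "quasi_subnet E y D x \<longleftrightarrow> (\<forall>i\<^sub>0\<in>elems D. \<exists>j\<^sub>0\<in>elems E. y ` tail E j\<^sub>0 \<subseteq> x ` tail D i\<^sub>0)"

definition net_convergence_structure :: "('i, 'v) net_convergence \<Rightarrow> bool" where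
  "net_convergence_structure \<eta> \<longleftrightarrow>
    (\<forall>D x v. \<eta> D x v \<longrightarrow> directed_set D) \<and>
    (\<forall>D v. directed_set D \<longrightarrow> \<eta> D (\<lambda>_. v) v) \<and>
    (\<forall>D x E y v. \<eta> D x v \<and> directed_set E \<and> quasi_subnet E y D x \<longrightarrow> \<eta> E y v) \<and>
    (\<forall>D x y z v. \<eta> D x v \<and> \<eta> D y v \<and> (\<forall>i\<in>elems D. z i \<in> {x i, y i}) \<longrightarrow> \<eta> D z v)"

definition hausdorff_convergence :: "('i, 'v) net_convergence \<Rightarrow> bool" where
  "hausdorff_convergence \<eta> \<longleftrightarrow> (\<forall>D x v w. \<eta> D x v \<and> \<eta> D x w \<longrightarrow> v = w)"

definition linear_convergence :: "('i, 'v::real_vector) net_convergence \<Rightarrow> bool" where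
  "linear_convergence \<eta> \<longleftrightarrow>
    (\<forall>D x y v w. \<eta> D x v \<and> \<eta> D y w \<longrightarrow> \<eta> D (\<lambda>i. x i + y i) (v + w)) \<and>
    (\<forall>D x v c. \<eta> D x v \<longrightarrow> \<eta> D (\<lambda>i. c *\<^sub>R x i) (c *\<^sub>R v))"

definition locally_solid :: "('i, 'v::archimedean_riesz_space) net_convergence \<Rightarrow> bool" where
  "locally_solid \<eta> \<longleftrightarrow>
    (\<forall>E y D x. \<eta> E y 0 \<and> directed_set D \<and>
      (\<forall>l\<^sub>0\<in>elems E. \<exists>i\<^sub>0\<in>elems D. \<forall>i\<in>tail D i\<^sub>0. \<exists>l\<in>tail E l\<^sub>0. \<bar>x i\<bar> \<le> \<bar>y l\<bar>) \<longrightarrow>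
      \<eta> D x 0)"

definition riesz_convergence :: "('i, 'v::archimedean_riesz_space) net_convergence \<Rightarrow> bool" where
  "riesz_convergence \<eta> \<longleftrightarrow> net_convergence_structure \<eta> \<and> hausdorff_convergence \<eta> \<and>
    linear_convergence \<eta> \<and> locally_solid \<eta>"

definition net_continuous ::
  "('i, 'v) net_convergence \<Rightarrow> ('i, 'w) net_convergence \<Rightarrow> ('v \<Rightarrow> 'w) \<Rightarrow> bool" where
  "net_continuous \<eta> \<theta> T \<longleftrightarrow> (\<forall>D x v. \<eta> D x v \<longrightarrow> \<theta> D (\<lambda>i. T (x i)) (T v))"

definition D_converges_via ::
  "(nat \<Rightarrow> nat \<Rightarrow> 'z::archimedean_riesz_space) \<Rightarrow> ('i, 'z) net_convergence" where
  "D_converges_via a D x l \<longleftrightarrow> D_sequence a \<and>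
    (\<forall>\<phi>. \<exists>s. is_sup (range (\<lambda>j. a j (\<phi> j))) s \<and>
      (\<exists>i\<^sub>0\<in>elems D. \<forall>i\<in>tail D i\<^sub>0. \<bar>x i - l\<bar> \<le> s))"

definition D_convergence :: "('i, 'z::archimedean_riesz_space) net_convergence" where
  "D_convergence D x l \<longleftrightarrow> directed_set D \<and> (\<exists>a. D_converges_via a D x l)"


section \<open>Partially ordered integration structures\<close>

text \<open>\<open>\<Gamma> S A\<close> is the directed set attached to \<open>A\<close>; for \<open>\<gamma>\<close> in it, \<open>fam S A \<gamma>\<close> is the
  finite index set \<open>I\<^sub>\<gamma>\<close>, \<open>piece S A \<gamma>\<close> the family \<open>\<sigma>\<^sub>\<gamma>\<close> and \<open>tag S A \<gamma>\<close> the
  family \<open>\<tau>\<^sub>\<gamma>\<close>.\<close>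

record ('w, 'i, 'k, 'x, 'y, 'z) integration_structure =
  Om :: "'w set"
  Hsets :: "'w set set"
  \<Gamma> :: "'w set \<Rightarrow> 'i index_set"
  fam :: "'w set \<Rightarrow> 'i \<Rightarrow> 'k set"
  piece :: "'w set \<Rightarrow> 'i \<Rightarrow> 'k \<Rightarrow> 'w set"
  tag :: "'w set \<Rightarrow> 'i \<Rightarrow> 'k \<Rightarrow> 'w"
  conv1 :: "('i, 'x) net_convergence"
  conv2 :: "('i, 'y) net_convergence"
  conv3 :: "('i, 'z) net_convergence"
  prd :: "'x \<Rightarrow> 'y \<Rightarrow> 'z"

definition riesz_product ::
  "('i, 'x::archimedean_riesz_space) net_convergence \<Rightarrow>
   ('i, 'y::archimedean_riesz_space) net_convergence \<Rightarrow>
   ('i, 'z::archimedean_riesz_space) net_convergence \<Rightarrow> ('x \<Rightarrow> 'y \<Rightarrow> 'z) \<Rightarrow> bool" where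
  "riesz_product \<eta>\<^sub>1 \<eta>\<^sub>2 \<eta>\<^sub>3 b \<longleftrightarrow>
    bilinear b \<and>
    (\<forall>y. net_continuous \<eta>\<^sub>1 \<eta>\<^sub>3 (\<lambda>x. b x y)) \<and>
    (\<forall>x. net_continuous \<eta>\<^sub>2 \<eta>\<^sub>3 (\<lambda>y. b x y)) \<and>
    (\<forall>x x' y y'. 0 \<le> x \<and> x \<le> x' \<and> 0 \<le> y \<and> y \<le> y' \<longrightarrow> b x y \<le> b x' y') \<and>
    (\<forall>(x::nat \<Rightarrow> 'x) y s. (\<forall>n. 0 \<le> x n) \<and> 0 \<le> y \<and> is_sup (range x) s \<longrightarrow>
      is_sup (range (\<lambda>n. b (x n) y)) (b s y)) \<and>
    (\<forall>x (y::nat \<Rightarrow> 'y) s. 0 \<le> x \<and> (\<forall>n. 0 \<le> y n) \<and> is_sup (range y) s \<longrightarrow>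
      is_sup (range (\<lambda>n. b x (y n))) (b x s))"

definition po_integration_structure ::
  "('w, 'i, 'k, 'x::archimedean_riesz_space, 'y::archimedean_riesz_space,
    'z::archimedean_riesz_space) integration_structure \<Rightarrow> bool" where
  "po_integration_structure S \<longleftrightarrow>
    Hsets S \<subseteq> Pow (Om S) \<and>
    (\<forall>A\<in>Hsets S. directed_set (\<Gamma> S A)) \<and>
    (\<forall>A\<in>Hsets S. \<forall>\<gamma>\<in>elems (\<Gamma> S A). finite (fam S A \<gamma>) \<and>
      (\<forall>i\<in>fam S A \<gamma>. piece S A \<gamma> i \<in> Hsets S \<and> tag S A \<gamma> i \<in> Om S)) \<and>
    riesz_convergence (conv1 S) \<and> riesz_convergence (conv2 S) \<and> riesz_convergence (conv3 S) \<and>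
    riesz_product (conv1 S) (conv2 S) (conv3 S) (prd S)"

definition nets_additive_for ::
  "('w, 'i, 'k, 'x, 'y::comm_monoid_add, 'z) integration_structure \<Rightarrow> ('w set \<Rightarrow> 'y) \<Rightarrow> bool" where
  "nets_additive_for S \<mu> \<longleftrightarrow>
    (\<forall>A\<in>Hsets S. \<forall>\<gamma>\<in>elems (\<Gamma> S A).
      (\<Sum>i\<in>fam S A \<gamma>. \<mu> (piece S A \<gamma> i)) = \<mu> (\<Union>i\<in>fam S A \<gamma>. piece S A \<gamma> i))"

definition riemann_sum ::
  "('w, 'i, 'k, 'x, 'y, 'z::comm_monoid_add) integration_structure \<Rightarrow>
   ('w set \<Rightarrow> 'y) \<Rightarrow> ('w \<Rightarrow> 'x) \<Rightarrow> 'w set \<Rightarrow> 'i \<Rightarrow> 'z" where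
  "riemann_sum S \<mu> f A \<gamma> =
    (\<Sum>i\<in>fam S A \<gamma>. prd S (f (tag S A \<gamma> i)) (\<mu> (piece S A \<gamma> i)))"

definition has_net_integral ::
  "('w, 'i, 'k, 'x, 'y, 'z::comm_monoid_add) integration_structure \<Rightarrow>
   ('w set \<Rightarrow> 'y) \<Rightarrow> ('w \<Rightarrow> 'x) \<Rightarrow> 'w set \<Rightarrow> 'z \<Rightarrow> bool" where
  "has_net_integral S \<mu> f A z \<longleftrightarrow> conv3 S (\<Gamma> S A) (riemann_sum S \<mu> f A) z"

definition net_integrable_on ::
  "('w, 'i, 'k, 'x, 'y, 'z::comm_monoid_add) integration_structure \<Rightarrow>
   ('w set \<Rightarrow> 'y) \<Rightarrow> ('w \<Rightarrow> 'x) \<Rightarrow> 'w set \<Rightarrow> bool" where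
  "net_integrable_on S \<mu> f A \<longleftrightarrow> (\<exists>z. has_net_integral S \<mu> f A z)"

definition net_integral ::
  "('w, 'i, 'k, 'x, 'y, 'z::comm_monoid_add) integration_structure \<Rightarrow>
   ('w set \<Rightarrow> 'y) \<Rightarrow> ('w \<Rightarrow> 'x) \<Rightarrow> 'w set \<Rightarrow> 'z" where
  "net_integral S \<mu> f A = (THE z. has_net_integral S \<mu> f A z)"

definition net_riemann_integrable ::
  "('w, 'i, 'k, 'x, 'y, 'z::comm_monoid_add) integration_structure \<Rightarrow>
   ('w set \<Rightarrow> 'y) \<Rightarrow> ('w \<Rightarrow> 'x) \<Rightarrow> bool" where
  "net_riemann_integrable S \<mu> f \<longleftrightarrow> (\<forall>A\<in>Hsets S. net_integrable_on S \<mu> f A)"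


section \<open>The Henstock property\<close>

text \<open>The tagged family of \<open>\<gamma>\<close> restricted to \<open>J \<subseteq> I\<^sub>\<gamma>\<close>, up to reindexing. A multiset is
  used since the same tagged set may occur several times.\<close>

definition tagged_family ::
  "('w, 'i, 'k, 'x, 'y, 'z) integration_structure \<Rightarrow> 'w set \<Rightarrow> 'i \<Rightarrow> 'k set \<Rightarrow>
   ('w set \<times> 'w) multiset" where
  "tagged_family S A \<gamma> J = image_mset (\<lambda>i. (piece S A \<gamma> i, tag S A \<gamma> i)) (mset_set J)"

definition henstock_H1 ::
  "('w, 'i, 'k, 'x, 'y, 'z::comm_monoid_add) integration_structure \<Rightarrow>
   ('w set \<Rightarrow> 'y) \<Rightarrow> ('w \<Rightarrow> 'x) \<Rightarrow> bool" where
  "henstock_H1 S \<mu> g \<longleftrightarrow>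
    (\<forall>B\<in>Hsets S. net_integrable_on S \<mu> g B \<longrightarrow>
      (\<forall>A\<in>Hsets S. A \<subseteq> B \<longrightarrow> net_integrable_on S \<mu> g A))"

definition henstock_H2 ::
  "('w, 'i, 'k, 'x, 'y, 'z::comm_monoid_add) integration_structure \<Rightarrow>
   ('w set \<Rightarrow> 'y) \<Rightarrow> ('w \<Rightarrow> 'x) \<Rightarrow> bool" where
  "henstock_H2 S \<mu> g \<longleftrightarrow>
    (\<forall>B\<in>Hsets S. net_integrable_on S \<mu> g B \<longrightarrow>
      (\<forall>\<gamma>\<in>elems (\<Gamma> S B). \<forall>J\<subseteq>fam S B \<gamma>.
        net_integral S \<mu> g (\<Union>j\<in>J. piece S B \<gamma> j) =
        (\<Sum>j\<in>J. net_integral S \<mu> g (piece S B \<gamma> j))))"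

definition henstock_H3 ::
  "('w, 'i, 'k, 'x, 'y, 'z::comm_monoid_add) integration_structure \<Rightarrow>
   ('w set \<Rightarrow> 'y) \<Rightarrow> ('w \<Rightarrow> 'x) \<Rightarrow> bool" where
  "henstock_H3 S \<mu> g \<longleftrightarrow>
    (\<forall>B\<in>Hsets S. net_integrable_on S \<mu> g B \<longrightarrow>
      (\<forall>\<gamma>\<in>elems (\<Gamma> S B). (\<Union>i\<in>fam S B \<gamma>. piece S B \<gamma> i) = B))"

definition henstock_H4 ::
  "('w, 'i, 'k, 'x, 'y, 'z::comm_monoid_add) integration_structure \<Rightarrow>
   ('w set \<Rightarrow> 'y) \<Rightarrow> ('w \<Rightarrow> 'x) \<Rightarrow> bool" where
  "henstock_H4 S \<mu> g \<longleftrightarrow>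
    (\<forall>B\<in>Hsets S. net_integrable_on S \<mu> g B \<longrightarrow>
      (\<forall>\<gamma>\<in>elems (\<Gamma> S B). \<forall>J\<subseteq>fam S B \<gamma>.
        let U = (\<Union>j\<in>J. piece S B \<gamma> j) in
        \<forall>\<gamma>0\<in>elems (\<Gamma> S U). \<exists>\<gamma>1\<in>tail (\<Gamma> S U) \<gamma>0. \<exists>\<gamma>B\<in>tail (\<Gamma> S B) \<gamma>.
          tagged_family S B \<gamma>B (fam S B \<gamma>B) =
          tagged_family S U \<gamma>1 (fam S U \<gamma>1) + tagged_family S B \<gamma> (fam S B \<gamma> - J)))"

definition integral_finitely_additive ::
  "('w, 'i, 'k, 'x, 'y, 'z::comm_monoid_add) integration_structure \<Rightarrow>
   ('w set \<Rightarrow> 'y) \<Rightarrow> ('w \<Rightarrow> 'x) \<Rightarrow> bool" where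
  "integral_finitely_additive S \<mu> g \<longleftrightarrow>
    (\<forall>B\<in>Hsets S. net_integrable_on S \<mu> g B \<longrightarrow>
      (\<forall>A\<in>Hsets S. \<forall>C\<in>Hsets S. A \<inter> C = {} \<and> A \<union> C = B \<longrightarrow>
        net_integral S \<mu> g B = net_integral S \<mu> g A + net_integral S \<mu> g C))"

text \<open>\<open>\<gamma>0\<close> is an index as provided by the definition of the integral of \<open>g\<close> on \<open>A\<close> with
  respect to \<open>(D)\<close>-convergence, for some regulator \<open>a\<close> and some \<open>\<phi>\<close>.\<close>

definition integrability_index ::
  "('w, 'i, 'k, 'x, 'y, 'z::archimedean_riesz_space) integration_structure \<Rightarrow>
   ('w set \<Rightarrow> 'y) \<Rightarrow> ('w \<Rightarrow> 'x) \<Rightarrow> 'w set \<Rightarrow> 'i \<Rightarrow> bool" where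
  "integrability_index S \<mu> g A \<gamma>0 \<longleftrightarrow> \<gamma>0 \<in> elems (\<Gamma> S A) \<and>
    (\<exists>a \<phi> s. D_converges_via a (\<Gamma> S A) (riemann_sum S \<mu> g A) (net_integral S \<mu> g A) \<and>
      is_sup (range (\<lambda>j. a j (\<phi> j))) s \<and>
      (\<forall>\<gamma>\<in>tail (\<Gamma> S A) \<gamma>0. \<bar>riemann_sum S \<mu> g A \<gamma> - net_integral S \<mu> g A\<bar> \<le> s))"

definition henstock_H4' ::
  "('w, 'i, 'k, 'x, 'y, 'z::archimedean_riesz_space) integration_structure \<Rightarrow>
   ('w set \<Rightarrow> 'y) \<Rightarrow> ('w \<Rightarrow> 'x) \<Rightarrow> bool" where
  "henstock_H4' S \<mu> g \<longleftrightarrow>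
    (\<forall>B\<in>Hsets S. net_integrable_on S \<mu> g B \<longrightarrow>
      (\<forall>\<gamma>\<in>elems (\<Gamma> S B). \<forall>J\<subseteq>fam S B \<gamma>.
        let F = B - (\<Union>j\<in>J. piece S B \<gamma> j) in
        \<forall>\<gamma>F0 \<gamma>B0. integrability_index S \<mu> g F \<gamma>F0 \<and> integrability_index S \<mu> g B \<gamma>B0 \<longrightarrow>
          (\<exists>\<gamma>F\<in>elems (\<Gamma> S F). \<exists>\<gamma>B\<in>tail (\<Gamma> S B) \<gamma>B0.
            tagged_family S B \<gamma>B (fam S B \<gamma>B) =
            tagged_family S F \<gamma>F (fam S F \<gamma>F) + tagged_family S B \<gamma> J)))"

definition henstock_property ::
  "('w, 'i, 'k, 'x, 'y, 'z::archimedean_riesz_space) integration_structure \<Rightarrow>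
   ('w set \<Rightarrow> 'y) \<Rightarrow> ('w \<Rightarrow> 'x) \<Rightarrow> bool" where
  "henstock_property S \<mu> g \<longleftrightarrow>
    henstock_H1 S \<mu> g \<and> henstock_H3 S \<mu> g \<and>
    ((henstock_H2 S \<mu> g \<and> henstock_H4 S \<mu> g) \<or>
     (integral_finitely_additive S \<mu> g \<and> henstock_H4' S \<mu> g))"


section \<open>Sequences of functions\<close>

definition converges_with_common_regulator ::
  "'w set \<Rightarrow> (nat \<Rightarrow> 'w \<Rightarrow> 'x::archimedean_riesz_space) \<Rightarrow> ('w \<Rightarrow> 'x) \<Rightarrow> bool" where
  "converges_with_common_regulator \<Omega> f f\<^sub>0 \<longleftrightarrow>
    (\<exists>a. D_sequence a \<and>
      (\<forall>\<phi>. \<exists>s. is_sup (range (\<lambda>i. a i (\<phi> i))) s \<and>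
        (\<forall>\<omega>\<in>\<Omega>. \<exists>p. \<forall>n\<ge>p. \<bar>f n \<omega> - f\<^sub>0 \<omega>\<bar> \<le> s)))"

text \<open>Here \<open>s n\<close> is \<open>\<Or>\<^sub>i a\<^bsub>ni\<phi>(i+n+1)\<^esub>\<close>. As \<open>\<phi>\<close> ranges over all
  sequences, it makes no difference whether indices start from 0 or from 1.\<close>

definition uniformly_regulated_integrals ::
  "('w, 'i, 'k, 'x, 'y, 'z::archimedean_riesz_space) integration_structure \<Rightarrow>
   ('w set \<Rightarrow> 'y) \<Rightarrow> (nat \<Rightarrow> 'w \<Rightarrow> 'x) \<Rightarrow> bool" where
  "uniformly_regulated_integrals S \<mu> f \<longleftrightarrow>
    (\<exists>a::nat \<Rightarrow> nat \<Rightarrow> nat \<Rightarrow> 'z.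
      (\<forall>n i j. 0 \<le> a n i j) \<and>
      (\<forall>n. \<exists>u. \<forall>i j. a n i j \<le> u) \<and>
      (\<forall>n i. decreases_to_zero (a n i)) \<and>
      (\<forall>\<phi>::nat \<Rightarrow> nat. \<exists>s::nat \<Rightarrow> 'z.
        (\<forall>n. is_sup (range (\<lambda>i. a n i (\<phi> (i + n + 1)))) (s n)) \<and>
        (\<exists>u. \<forall>m. (\<Sum>n\<le>m. s n) \<le> u) \<and>
        (\<forall>n. \<forall>A\<in>Hsets S. \<exists>\<gamma>n\<in>elems (\<Gamma> S A). \<forall>\<gamma>\<in>tail (\<Gamma> S A) \<gamma>n.
          \<bar>net_integral S \<mu> (f n) A - riemann_sum S \<mu> (f n) A \<gamma>\<bar> \<le> s n)))"

definition uniformly_approximable_integrals ::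
  "('w, 'i, 'k, 'x, 'y, 'z::archimedean_riesz_space) integration_structure \<Rightarrow>
   ('w set \<Rightarrow> 'y) \<Rightarrow> (nat \<Rightarrow> 'w \<Rightarrow> 'x) \<Rightarrow> bool" where
  "uniformly_approximable_integrals S \<mu> f \<longleftrightarrow>
    (\<exists>b::nat \<Rightarrow> nat \<Rightarrow> 'z. D_sequence b \<and>
      (\<forall>\<phi>. \<exists>s. is_sup (range (\<lambda>i. b i (\<phi> i))) s \<and>
        (\<forall>A\<in>Hsets S. \<exists>\<gamma>0\<in>elems (\<Gamma> S A). \<forall>\<gamma>\<in>tail (\<Gamma> S A) \<gamma>0. \<forall>n.
          \<bar>net_integral S \<mu> (f n) A - riemann_sum S \<mu> (f n) A \<gamma>\<bar> \<le> s)))"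

end

theory Submission
  imports Defs
begin

text \<open>
  The theorem is an interchange of two limits of the array \<open>R n \<gamma>\<close> of Riemann sums of
  \<open>f n\<close> over \<open>A\<close>. For fixed \<open>n\<close> the limit along \<open>\<Gamma>(A)\<close> is the integral of \<open>f n\<close>, and uniform
  approximability says that this limit is uniform in \<open>n\<close>, with a regulator \<open>b\<close> in \<open>Z\<close>. For fixed
  \<open>\<gamma>\<close> the limit in \<open>n\<close> is the Riemann sum of \<open>f\<^sub>0\<close>: there are finitely many tags, so from some \<open>n\<close> on
  \<open>f n\<close> is within \<open>s = \<Or>\<^sub>i a\<^bsub>i\<phi>(i)\<^esub>\<close> of \<open>f\<^sub>0\<close> at all of them, and since the pieces of \<open>\<gamma>\<close> have
  total mass at most \<open>\<mu>(\<Omega>)\<close>, the two sums differ by at most \<open>s\<mu>(\<Omega>)\<close>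
  (\<open>riemann_sum_diff_le\<close>, \<open>partition_mass_le\<close>). The product respects countable suprema, so
  \<open>s\<mu>(\<Omega>)\<close> is the supremum belonging to the \<open>(D)\<close>-sequence \<open>a\<^sub>i\<^sub>j\<mu>(\<Omega>)\<close> of \<open>Z\<close>.

  The interchange is the Moore--Osgood theorem for regulated convergence
  (\<open>moore_osgood_regulated\<close>). The two regulators are merged into one, \<open>c\<close>
  (\<open>D_sequences_dominate_sum\<close>), such that for every \<open>\<psi>\<close> some Riemann sum of \<open>f\<^sub>0\<close> is
  within \<open>\<Or>\<^sub>i c\<^bsub>i\<psi>(i)\<^esub>\<close> of the integral of \<open>f n\<close> for all large \<open>n\<close>. The integrals thus oscillate by at
  most twice this supremum. Weak \<open>\<sigma>\<close>-distributivity says that these suprema have infimum 0, and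
  then \<open>\<sigma>\<close>-Dedekind completeness provides the order limit (\<open>o_Cauchy_imp_o_limit\<close>). Letting \<open>n\<close>
  tend to infinity in the same estimate, the Riemann sums of \<open>f\<^sub>0\<close> \<open>(D)\<close>-converge to it.
\<close>

section \<open>Suprema, infima and regulators\<close>

lemma is_sup_iff:
  "is_sup S s \<longleftrightarrow> (\<forall>x\<in>S. x \<le> s) \<and> (\<forall>u. (\<forall>x\<in>S. x \<le> u) \<longrightarrow> s \<le> u)"
  by (auto simp: isLub_def leastP_def isUb_def setle_def setge_def)

lemma is_inf_iff:
  "is_inf S s \<longleftrightarrow> (\<forall>x\<in>S. s \<le> x) \<and> (\<forall>u. (\<forall>x\<in>S. u \<le> x) \<longrightarrow> u \<le> s)"
  by (auto simp: isGlb_def greatestP_def isLb_def setle_def setge_def)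

lemma is_sup_upper: "is_sup (range g) s \<Longrightarrow> g i \<le> s"
  by (auto simp: is_sup_iff)

lemma is_sup_least: "is_sup (range g) s \<Longrightarrow> (\<And>i. g i \<le> u) \<Longrightarrow> s \<le> u"
  by (auto simp: is_sup_iff)

lemma decreases_to_zero_iff:
  "decreases_to_zero w \<longleftrightarrow> decseq w \<and> (\<forall>n. 0 \<le> w n) \<and> (\<forall>u. (\<forall>n. u \<le> w n) \<longrightarrow> u \<le> 0)"
  by (auto simp: decreases_to_zero_def is_inf_iff)

lemma D_sequence_sup_nonneg:
  assumes "D_sequence a" "is_sup (range (\<lambda>i. a i (\<phi> i))) s"
  shows "0 \<le> s"
  using assms is_sup_upper[OF assms(2), of 0]
  unfolding D_sequence_def decreases_to_zero_iff by (meson order_trans)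

lemma is_sup_scale:
  fixes g :: "nat \<Rightarrow> 'z::archimedean_riesz_space"
  assumes "is_sup (range g) s" "0 < c"
  shows "is_sup (range (\<lambda>i. c *\<^sub>R g i)) (c *\<^sub>R s)"
  unfolding is_sup_iff
proof (intro conjI allI impI ballI)
  fix x assume "x \<in> range (\<lambda>i. c *\<^sub>R g i)"
  then show "x \<le> c *\<^sub>R s"
    using is_sup_upper[OF assms(1)] assms(2) by (auto intro!: scaleR_left_mono)
next
  fix u assume u: "\<forall>x\<in>range (\<lambda>i. c *\<^sub>R g i). x \<le> u"
  have "g i \<le> u /\<^sub>R c" for i
    using u assms(2) by (simp add: pos_le_divideR_eq)
  then have "s \<le> u /\<^sub>R c" by (rule is_sup_least[OF assms(1)])
  then show "c *\<^sub>R s \<le> u" using assms(2) by (simp add: pos_le_divideR_eq)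
qed

lemma decreases_to_zero_scale:
  fixes w :: "nat \<Rightarrow> 'z::archimedean_riesz_space"
  assumes "decreases_to_zero w" "0 < c"
  shows "decreases_to_zero (\<lambda>n. c *\<^sub>R w n)"
  unfolding decreases_to_zero_iff
proof (intro conjI allI impI)
  show "decseq (\<lambda>n. c *\<^sub>R w n)"
    using assms by (auto simp: decreases_to_zero_iff decseq_def intro!: scaleR_left_mono)
  show "0 \<le> c *\<^sub>R w n" for n
    using assms by (auto simp: decreases_to_zero_iff intro!: scaleR_nonneg_nonneg)
  fix u assume "\<forall>n. u \<le> c *\<^sub>R w n"
  then have "\<forall>n. u /\<^sub>R c \<le> w n"
    using assms(2) by (simp add: pos_divideR_le_eq)
  then have "u /\<^sub>R c \<le> 0"
    using assms(1) by (simp add: decreases_to_zero_iff)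
  then show "u \<le> 0" using assms(2) by (simp add: pos_divideR_le_eq)
qed

text \<open>The sequence \<open>c\<close> lists the terms of \<open>2a\<close> and \<open>2b\<close> alternately: its suprema are joins
  \<open>2s \<squnion> 2t\<close>, which lie above \<open>s + t\<close>. In this way sums of error bounds governed by two
  regulators become error bounds governed by a single one, whose suprema still exist.\<close>

lemma D_sequences_dominate_sum:
  fixes a b :: "nat \<Rightarrow> nat \<Rightarrow> 'z::archimedean_riesz_space"
  assumes a: "D_sequence a" "\<And>\<phi>. \<exists>s. is_sup (range (\<lambda>i. a i (\<phi> i))) s"
    and b: "D_sequence b" "\<And>\<phi>. \<exists>s. is_sup (range (\<lambda>i. b i (\<phi> i))) s"
  obtains c where "D_sequence c"
    "\<And>\<psi>. \<exists>\<phi> r. is_sup (range (\<lambda>i. c i (\<psi> i))) r \<and>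
      (\<forall>s t. is_sup (range (\<lambda>i. a i (\<phi> i))) s \<longrightarrow> is_sup (range (\<lambda>i. b i (\<phi> i))) t \<longrightarrow> s + t \<le> r)"
proof
  define c where "c = (\<lambda>i j. if even i then 2 *\<^sub>R a (i div 2) j else 2 *\<^sub>R b (i div 2) j)"
  have c_even: "c (2 * i) j = 2 *\<^sub>R a i j" and c_odd: "c (2 * i + 1) j = 2 *\<^sub>R b i j" for i j
    by (simp_all add: c_def)
  show "D_sequence c"
    unfolding D_sequence_def
  proof
    show "decreases_to_zero (c i)" for i
      using a(1) b(1)
      by (cases "even i") (simp_all add: c_def D_sequence_def decreases_to_zero_scale)
  qed
  fix \<psi> :: "nat \<Rightarrow> nat"
  \<comment> \<open>\<open>\<psi>\<close> prescribes different indices for \<open>a\<close> and \<open>b\<close>; since both decrease, the larger index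
    serves for both.\<close>
  define \<phi> where "\<phi> = (\<lambda>i. max (\<psi> (2 * i)) (\<psi> (2 * i + 1)))"
  obtain s' where s': "is_sup (range (\<lambda>i. a i (\<psi> (2 * i)))) s'"
    using a(2)[of "\<lambda>i. \<psi> (2 * i)"] by blast
  obtain t' where t': "is_sup (range (\<lambda>i. b i (\<psi> (2 * i + 1)))) t'"
    using b(2)[of "\<lambda>i. \<psi> (2 * i + 1)"] by blast
  define r where "r = sup (2 *\<^sub>R s') (2 *\<^sub>R t')"
  have "is_sup (range (\<lambda>i. c i (\<psi> i))) r"
    unfolding is_sup_iff
  proof (intro conjI allI impI ballI)
    fix x assume "x \<in> range (\<lambda>i. c i (\<psi> i))"
    then obtain i where x: "x = c i (\<psi> i)" by blast
    show "x \<le> r"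
    proof (cases "even i")
      case True
      then obtain k where "i = 2 * k" by (auto elim: evenE)
      then have "x \<le> 2 *\<^sub>R s'"
        using is_sup_upper[OF s', of k] x c_even by (auto intro!: scaleR_left_mono)
      then show ?thesis by (simp add: r_def le_supI1)
    next
      case False
      then obtain k where "i = 2 * k + 1" by (auto elim: oddE)
      then have "x \<le> 2 *\<^sub>R t'"
        using is_sup_upper[OF t', of k] x c_odd[of k] by (auto intro!: scaleR_left_mono)
      then show ?thesis by (simp add: r_def le_supI2)
    qed
  next
    fix u assume "\<forall>x\<in>range (\<lambda>i. c i (\<psi> i)). x \<le> u"
    then have u: "c i (\<psi> i) \<le> u" for i by blast
    have "2 *\<^sub>R s' \<le> u"
      using u[of "2 * _"] by (intro is_sup_least[OF is_sup_scale[OF s']]) (simp_all add: c_even)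
    moreover have "2 *\<^sub>R t' \<le> u"
      using u[of "2 * _ + 1"] unfolding c_odd
      by (intro is_sup_least[OF is_sup_scale[OF t']]) simp_all
    ultimately show "r \<le> u" by (simp add: r_def)
  qed
  moreover have "s + t \<le> r"
    if s: "is_sup (range (\<lambda>i. a i (\<phi> i))) s" and t: "is_sup (range (\<lambda>i. b i (\<phi> i))) t" for s t
  proof -
    have "a i (\<phi> i) \<le> a i (\<psi> (2 * i))" "b i (\<phi> i) \<le> b i (\<psi> (2 * i + 1))" for i
      using a(1) b(1) by (auto simp: \<phi>_def D_sequence_def decreases_to_zero_iff decseq_def)
    then have "s \<le> s'" "t \<le> t'"
      using is_sup_least[OF s] is_sup_upper[OF s'] is_sup_least[OF t] is_sup_upper[OF t']
      by (blast intro: order_trans)+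
    then have "2 *\<^sub>R s \<le> 2 *\<^sub>R s'" "2 *\<^sub>R t \<le> 2 *\<^sub>R t'"
      by (auto intro!: scaleR_left_mono)
    then have "2 *\<^sub>R s \<le> r" "2 *\<^sub>R t \<le> r"
      unfolding r_def by (simp_all add: le_supI1 le_supI2)
    then have "2 *\<^sub>R s + 2 *\<^sub>R t \<le> r + r" by (rule add_mono)
    then have "2 *\<^sub>R (s + t) \<le> 2 *\<^sub>R r" by (simp only: scaleR_add_right scaleR_2)
    then show ?thesis by (simp add: scaleR_le_cancel_left_pos)
  qed
  ultimately show "\<exists>\<phi> r. is_sup (range (\<lambda>i. c i (\<psi> i))) r \<and>
      (\<forall>s t. is_sup (range (\<lambda>i. a i (\<phi> i))) s \<longrightarrow> is_sup (range (\<lambda>i. b i (\<phi> i))) t \<longrightarrow> s + t \<le> r)"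
    by blast
qed

section \<open>Interchange of limits\<close>

lemma sigma_dedekind_complete_sup:
  fixes y :: "nat \<Rightarrow> 'z::order"
  assumes "sigma_dedekind_complete TYPE('z)" "I \<noteq> {}" "\<And>i. y i \<le> u"
  shows "\<exists>s. is_sup (y ` I) s"
proof -
  have "y ` I \<noteq> {} \<and> countable (y ` I) \<and> (\<exists>u. \<forall>x\<in>y ` I. x \<le> u)"
    using assms(2,3) by auto
  then show ?thesis using assms(1) unfolding sigma_dedekind_complete_def by simp
qed

text \<open>The limit superior and the limit inferior exist, because a Cauchy sequence is order bounded;
  the gap between the supremum and the infimum of a tail is below every element of \<open>E\<close>
  eventually, hence decreases to zero and is the required rate of convergence. The set \<open>E\<close> of
  admissible errors is arbitrary, so that a set indexed by all \<open>\<phi>\<close>, which is not countable,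
  can be used.\<close>

lemma o_Cauchy_imp_o_limit:
  fixes x :: "nat \<Rightarrow> 'z::archimedean_riesz_space"
  assumes complete: "sigma_dedekind_complete TYPE('z)"
    and E: "E \<noteq> {}" "\<And>u. (\<And>e. e \<in> E \<Longrightarrow> u \<le> e) \<Longrightarrow> u \<le> 0"
    and Cauchy: "\<And>e. e \<in> E \<Longrightarrow> \<exists>p. \<forall>m\<ge>p. \<forall>n\<ge>p. x m - x n \<le> e"
  obtains l where "o_limit x l"
proof -
  obtain e p where e: "\<forall>m\<ge>p. \<forall>n\<ge>p. x m - x n \<le> e"
    using E(1) Cauchy by blast
  define B where "B = (\<Sum>k\<le>p. \<bar>x k\<bar>) + \<bar>e\<bar>"
  have below: "\<bar>x k\<bar> \<le> (\<Sum>k\<le>p. \<bar>x k\<bar>)" if "k \<le> p" for k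
    using that sum_mono2[of "{..p}" "{k}" "\<lambda>k. \<bar>x k\<bar>"] by simp
  have bounded: "\<bar>x n\<bar> \<le> B" for n
  proof (cases "n \<le> p")
    case True
    then show ?thesis using below[of n] by (simp add: B_def add_increasing2)
  next
    case False
    then have "x n - x p \<le> e" "x p - x n \<le> e" using e by auto
    then have "\<bar>x n - x p\<bar> \<le> \<bar>e\<bar>"
      using abs_ge_self[of e] by (intro abs_leI) (auto intro: order_trans)
    moreover have "\<bar>x n\<bar> \<le> \<bar>x p\<bar> + \<bar>x n - x p\<bar>"
      using abs_triangle_ineq[of "x p" "x n - x p"] by simp
    moreover have "\<bar>x p\<bar> + \<bar>x n - x p\<bar> \<le> B"
      unfolding B_def by (intro add_mono below calculation) simp
    ultimately show ?thesis by (blast intro: order_trans)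
  qed
  then have bounds: "x n \<le> B" "- x n \<le> B" for n
    by (simp_all add: abs_le_iff)
  have ex_sup: "\<exists>s. is_sup (y ` {n..}) s" if "\<And>k. y k \<le> B" for y :: "nat \<Rightarrow> 'z" and n
    using that by (intro sigma_dedekind_complete_sup[OF complete]) auto
  \<comment> \<open>\<open>S n\<close> is the supremum and \<open>- T n\<close> the infimum of the tail from \<open>n\<close> on.\<close>
  define S where "S = (\<lambda>n. SOME s. is_sup (x ` {n..}) s)"
  define T where "T = (\<lambda>n. SOME t. is_sup ((\<lambda>k. - x k) ` {n..}) t)"
  have S: "is_sup (x ` {n..}) (S n)" for n
    unfolding S_def by (rule someI_ex[OF ex_sup[OF bounds(1)]])
  have T: "is_sup ((\<lambda>k. - x k) ` {n..}) (T n)" for n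
    unfolding T_def by (rule someI_ex[OF ex_sup[OF bounds(2)]])
  have S_upper: "x k \<le> S n" and T_upper: "- x k \<le> T n" if "n \<le> k" for k n
    using S[of n] T[of n] that by (auto simp: is_sup_iff)
  have S_least: "S n \<le> u" if "\<And>k. n \<le> k \<Longrightarrow> x k \<le> u" for n u
    using S[of n] that by (auto simp: is_sup_iff)
  have T_least: "T n \<le> u" if "\<And>k. n \<le> k \<Longrightarrow> - x k \<le> u" for n u
    using T[of n] that by (auto simp: is_sup_iff)
  have decS: "S n \<le> S m" and decT: "T n \<le> T m" if "m \<le> n" for m n
    using that by (auto intro!: S_least T_least S_upper T_upper)
  have cross: "- T m \<le> S n" for m n
    using S_upper[of n "max m n"] T_upper[of m "max m n"]
    by (metis max.cobounded1 max.cobounded2 minus_le_iff order_trans)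
  obtain l where l: "is_sup (range (\<lambda>m. - T m)) l"
    using sigma_dedekind_complete_sup[OF complete UNIV_not_empty, of "\<lambda>m. - T m", OF cross[of _ 0]]
    by (elim exE)
  have l_low: "- T n \<le> l" and l_upp: "l \<le> S n" for n
    using is_sup_upper[OF l] is_sup_least[OF l] cross by auto
  have "decreases_to_zero (\<lambda>n. S n + T n)"
    unfolding decreases_to_zero_iff
  proof (intro conjI allI impI)
    show "decseq (\<lambda>n. S n + T n)"
      by (auto simp: decseq_def intro!: add_mono decS decT)
    show "0 \<le> S n + T n" for n
      using add_right_mono[OF cross[of n n], of "T n"] by simp
    fix u assume u: "\<forall>n. u \<le> S n + T n"
    show "u \<le> 0"
    proof (rule E(2))
      fix e assume "e \<in> E"
      then obtain p where p: "\<forall>m\<ge>p. \<forall>n\<ge>p. x m - x n \<le> e" using Cauchy by blast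
      have "S p \<le> e + x n" if "p \<le> n" for n
        using p that by (intro S_least) (auto simp: algebra_simps)
      then have "T p \<le> e - S p"
        by (intro T_least) (auto simp: algebra_simps)
      then have "S p + T p \<le> e" by (simp add: algebra_simps)
      then show "u \<le> e" using u order_trans by blast
    qed
  qed
  moreover have "\<bar>x n - l\<bar> \<le> S n + T n" for n
  proof (rule abs_leI)
    have "x n - l \<le> S n - (- T n)"
      by (intro diff_mono S_upper l_low) auto
    then show "x n - l \<le> S n + T n" by simp
    have "l + - x n \<le> S n + T n"
      by (intro add_mono T_upper l_upp) auto
    then show "- (x n - l) \<le> S n + T n" by simp
  qed
  ultimately show ?thesis
    using that unfolding o_limit_def by blast
qed

text \<open>\<open>R n\<close> tends to \<open>I n\<close> along \<open>D\<close>, uniformly in \<open>n\<close>, while \<open>R n \<gamma>\<close> tends to \<open>R\<^sub>0 \<gamma>\<close> for each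
  \<open>\<gamma>\<close>, where only the regulator is common to all \<open>\<gamma>\<close> and the speed is not. The two iterated limits
  then exist and agree. The conclusion for \<open>I\<close> is the stronger order convergence, because
  the terms of a sequence form a countable set, to which \<open>\<sigma>\<close>-Dedekind completeness applies.\<close>

theorem moore_osgood_regulated:
  fixes R :: "nat \<Rightarrow> 'i \<Rightarrow> 'z::archimedean_riesz_space"
  assumes complete: "sigma_dedekind_complete TYPE('z)"
    and distributive: "weakly_sigma_distributive TYPE('z)"
    and D: "directed_set D"
    and a: "D_sequence a"
    and pointwise: "\<And>\<phi>. \<exists>s. is_sup (range (\<lambda>i. a i (\<phi> i))) s \<and>
      (\<forall>\<gamma>\<in>elems D. \<exists>p. \<forall>n\<ge>p. \<bar>R n \<gamma> - R\<^sub>0 \<gamma>\<bar> \<le> s)"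
    and b: "D_sequence b"
    and uniform: "\<And>\<phi>. \<exists>s. is_sup (range (\<lambda>i. b i (\<phi> i))) s \<and>
      (\<exists>\<gamma>\<^sub>0\<in>elems D. \<forall>\<gamma>\<in>tail D \<gamma>\<^sub>0. \<forall>n. \<bar>I n - R n \<gamma>\<bar> \<le> s)"
  obtains l where "o_limit I l" "D_convergence D R\<^sub>0 l"
proof -
  have a_sup: "\<exists>s. is_sup (range (\<lambda>i. a i (\<phi> i))) s" for \<phi>
    using pointwise[of \<phi>] by blast
  have b_sup: "\<exists>s. is_sup (range (\<lambda>i. b i (\<phi> i))) s" for \<phi>
    using uniform[of \<phi>] by blast
  obtain c where c: "D_sequence c"
    and dominate: "\<And>\<psi>. \<exists>\<phi> r. is_sup (range (\<lambda>i. c i (\<psi> i))) r \<and>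
      (\<forall>s t. is_sup (range (\<lambda>i. a i (\<phi> i))) s \<longrightarrow> is_sup (range (\<lambda>i. b i (\<phi> i))) t \<longrightarrow> s + t \<le> r)"
    using D_sequences_dominate_sum[OF a a_sup b b_sup] by blast
  have close: "\<exists>r. is_sup (range (\<lambda>i. c i (\<psi> i))) r \<and> (\<exists>\<gamma>\<^sub>0\<in>elems D. \<forall>\<gamma>\<in>tail D \<gamma>\<^sub>0.
      \<exists>p. \<forall>n\<ge>p. \<bar>R\<^sub>0 \<gamma> - I n\<bar> \<le> r)" for \<psi>
  proof -
    obtain \<phi> r where r: "is_sup (range (\<lambda>i. c i (\<psi> i))) r"
      and st: "\<And>s t. is_sup (range (\<lambda>i. a i (\<phi> i))) s \<Longrightarrow> is_sup (range (\<lambda>i. b i (\<phi> i))) t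
        \<Longrightarrow> s + t \<le> r"
      using dominate by blast
    obtain s where s: "is_sup (range (\<lambda>i. a i (\<phi> i))) s"
      "\<And>\<gamma>. \<gamma> \<in> elems D \<Longrightarrow> \<exists>p. \<forall>n\<ge>p. \<bar>R n \<gamma> - R\<^sub>0 \<gamma>\<bar> \<le> s"
      using pointwise by blast
    obtain t \<gamma>\<^sub>0 where t: "is_sup (range (\<lambda>i. b i (\<phi> i))) t" "\<gamma>\<^sub>0 \<in> elems D"
      "\<And>\<gamma> n. \<gamma> \<in> tail D \<gamma>\<^sub>0 \<Longrightarrow> \<bar>I n - R n \<gamma>\<bar> \<le> t"
      using uniform by blast
    have "\<exists>p. \<forall>n\<ge>p. \<bar>R\<^sub>0 \<gamma> - I n\<bar> \<le> r" if \<gamma>: "\<gamma> \<in> tail D \<gamma>\<^sub>0" for \<gamma>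
    proof -
      have "\<gamma> \<in> elems D" using \<gamma> by (simp add: tail_def)
      then obtain p where p: "\<And>n. n \<ge> p \<Longrightarrow> \<bar>R n \<gamma> - R\<^sub>0 \<gamma>\<bar> \<le> s" using s(2) by blast
      have "\<bar>R\<^sub>0 \<gamma> - I n\<bar> \<le> r" if "n \<ge> p" for n
      proof -
        have "\<bar>R\<^sub>0 \<gamma> - I n\<bar> \<le> \<bar>R n \<gamma> - R\<^sub>0 \<gamma>\<bar> + \<bar>I n - R n \<gamma>\<bar>"
          using abs_triangle_ineq[of "R n \<gamma> - R\<^sub>0 \<gamma>" "I n - R n \<gamma>"] by (simp add: abs_minus_commute)
        also have "\<dots> \<le> s + t" using p[OF that] t(3)[OF \<gamma>] by (rule add_mono)
        finally show ?thesis using st[OF s(1) t(1)] by (rule order_trans)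
      qed
      then show ?thesis by blast
    qed
    then show ?thesis using r t(2) by blast
  qed
  \<comment> \<open>Comparison of \<open>I m\<close> and \<open>I n\<close> through one value \<open>R\<^sub>0 \<gamma>\<^sub>0\<close> costs the error twice.\<close>
  define E where "E = {s. \<exists>\<psi>. is_sup (range (\<lambda>i. c i (\<psi> i))) s}"
  have E_sup: "is_inf E 0"
    using distributive c close unfolding weakly_sigma_distributive_def E_def by blast
  obtain l where l: "o_limit I l"
  proof (rule o_Cauchy_imp_o_limit[OF complete, where x = I and E = "(\<lambda>e. 2 *\<^sub>R e) ` E"])
    show "(\<lambda>e. 2 *\<^sub>R e) ` E \<noteq> {}" using close[of "\<lambda>_. 0"] by (auto simp: E_def)
    fix u assume u: "\<And>e. e \<in> (\<lambda>e. 2 *\<^sub>R e) ` E \<Longrightarrow> u \<le> e"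
    have "u /\<^sub>R 2 \<le> e" if "e \<in> E" for e
      using u[of "2 *\<^sub>R e"] that pos_divideR_le_eq[of 2 u e] by simp
    then have "u /\<^sub>R 2 \<le> 0" using E_sup by (simp add: is_inf_iff)
    then show "u \<le> 0" using pos_divideR_le_eq[of 2 u 0] by simp
  next
    fix e assume "e \<in> (\<lambda>e. 2 *\<^sub>R e) ` E"
    then obtain r' \<psi> where r': "e = 2 *\<^sub>R r'" "is_sup (range (\<lambda>i. c i (\<psi> i))) r'"
      by (auto simp: E_def)
    obtain r \<gamma>\<^sub>0 where r: "is_sup (range (\<lambda>i. c i (\<psi> i))) r" "\<gamma>\<^sub>0 \<in> elems D"
      "\<forall>\<gamma>\<in>tail D \<gamma>\<^sub>0. \<exists>p. \<forall>n\<ge>p. \<bar>R\<^sub>0 \<gamma> - I n\<bar> \<le> r"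
      using close by blast
    have "r = r'" using r(1) r'(2) by (meson antisym is_sup_iff)
    moreover have "\<gamma>\<^sub>0 \<in> tail D \<gamma>\<^sub>0" using D r(2) by (simp add: directed_set_def tail_def)
    ultimately obtain p where p: "\<And>n. n \<ge> p \<Longrightarrow> \<bar>R\<^sub>0 \<gamma>\<^sub>0 - I n\<bar> \<le> r'" using r(3) by blast
    have "I m - I n \<le> e" if "m \<ge> p" "n \<ge> p" for m n
    proof -
      have "I m - R\<^sub>0 \<gamma>\<^sub>0 \<le> r'" "R\<^sub>0 \<gamma>\<^sub>0 - I n \<le> r'"
        using p[OF that(1)] p[OF that(2)] by (simp_all add: abs_le_iff)
      then have "(I m - R\<^sub>0 \<gamma>\<^sub>0) + (R\<^sub>0 \<gamma>\<^sub>0 - I n) \<le> r' + r'" by (rule add_mono)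
      then show ?thesis by (simp add: r' scaleR_2)
    qed
    then show "\<exists>p. \<forall>m\<ge>p. \<forall>n\<ge>p. I m - I n \<le> e" by blast
  qed
  obtain w where w: "decreases_to_zero w" "\<And>n. \<bar>I n - l\<bar> \<le> w n"
    using l unfolding o_limit_def by blast
  have "D_converges_via c D R\<^sub>0 l"
    unfolding D_converges_via_def
  proof (intro conjI allI c)
    fix \<psi> :: "nat \<Rightarrow> nat"
    obtain r \<gamma>\<^sub>0 where r: "is_sup (range (\<lambda>i. c i (\<psi> i))) r" "\<gamma>\<^sub>0 \<in> elems D"
      "\<forall>\<gamma>\<in>tail D \<gamma>\<^sub>0. \<exists>p. \<forall>n\<ge>p. \<bar>R\<^sub>0 \<gamma> - I n\<bar> \<le> r"
      using close by blast
    have "\<bar>R\<^sub>0 \<gamma> - l\<bar> \<le> r" if \<gamma>: "\<gamma> \<in> tail D \<gamma>\<^sub>0" for \<gamma>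
    proof -
      obtain p where p: "\<And>n. n \<ge> p \<Longrightarrow> \<bar>R\<^sub>0 \<gamma> - I n\<bar> \<le> r" using r(3) \<gamma> by blast
      \<comment> \<open>The choice of \<open>\<gamma>\<^sub>0\<close> depends on \<open>\<psi>\<close> only, so \<open>n\<close> may still be taken as large as \<open>\<gamma>\<close> demands;
        the additional error \<open>w n\<close> then vanishes in the limit.\<close>
      have "\<bar>R\<^sub>0 \<gamma> - l\<bar> - r \<le> w n" for n
      proof -
        have "\<bar>R\<^sub>0 \<gamma> - l\<bar> \<le> \<bar>R\<^sub>0 \<gamma> - I (max n p)\<bar> + \<bar>I (max n p) - l\<bar>"
          using abs_triangle_ineq[of "R\<^sub>0 \<gamma> - I (max n p)" "I (max n p) - l"] by simp
        also have "\<dots> \<le> r + w (max n p)" by (intro add_mono p w) simp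
        also have "w (max n p) \<le> w n"
          using w(1) by (simp add: decreases_to_zero_iff decseq_def)
        finally show ?thesis by (simp add: algebra_simps)
      qed
      then have "\<bar>R\<^sub>0 \<gamma> - l\<bar> - r \<le> 0"
        using w(1) unfolding decreases_to_zero_iff by blast
      then show ?thesis by simp
    qed
    then show "\<exists>s. is_sup (range (\<lambda>j. c j (\<psi> j))) s \<and> (\<exists>i\<^sub>0\<in>elems D. \<forall>i\<in>tail D i\<^sub>0. \<bar>R\<^sub>0 i - l\<bar> \<le> s)"
      using r by blast
  qed
  then show ?thesis using that[OF l] D unfolding D_convergence_def by blast
qed

section \<open>Riemann sums\<close>

lemma riesz_product_sup:
  assumes "riesz_product \<eta>\<^sub>1 \<eta>\<^sub>2 \<eta>\<^sub>3 b"
    and "\<And>n::nat. 0 \<le> x n" "0 \<le> y" "is_sup (range x) s"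
  shows "is_sup (range (\<lambda>n. b (x n) y)) (b s y)"
  using assms unfolding riesz_product_def by simp

text \<open>Isotonicity is assumed for nonnegative first arguments only; it is therefore applied to
  \<open>\<bar>x\<bar> - x\<close> and \<open>\<bar>x\<bar> + x\<close>.\<close>

lemma riesz_product_abs_le:
  assumes "riesz_product \<eta>\<^sub>1 \<eta>\<^sub>2 \<eta>\<^sub>3 b" "0 \<le> y"
  shows "\<bar>b x y\<bar> \<le> b \<bar>x\<bar> y"
proof -
  have bil: "bilinear b" and mono: "\<And>x x' y y'. 0 \<le> x \<Longrightarrow> x \<le> x' \<Longrightarrow> 0 \<le> y \<Longrightarrow> y \<le> y' \<Longrightarrow> b x y \<le> b x' y'"
    using assms(1) unfolding riesz_product_def by blast+
  have "0 \<le> \<bar>x\<bar> - x" "0 \<le> \<bar>x\<bar> + x"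
    using abs_ge_self[of x] add_left_mono[OF abs_ge_minus_self[of x], of x] by (simp_all add: add.commute)
  then have "b 0 y \<le> b (\<bar>x\<bar> - x) y" "b 0 y \<le> b (\<bar>x\<bar> + x) y"
    using assms(2) by (auto intro!: mono)
  then have "0 \<le> b \<bar>x\<bar> y - b x y" "0 \<le> b \<bar>x\<bar> y + b x y"
    by (simp_all only: bilinear_lzero[OF bil] bilinear_lsub[OF bil] bilinear_ladd[OF bil])
  then show ?thesis
    using add_left_mono[of 0 "b \<bar>x\<bar> y + b x y" "- b x y"] by (intro abs_leI) simp_all
qed

text \<open>The product is assumed to preserve suprema of nonnegative sequences; the infimum of \<open>w\<close> is
  turned into the supremum of \<open>w 0 - w n\<close>, which is \<open>w 0\<close>.\<close>

lemma decreases_to_zero_product: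
  assumes prod: "riesz_product \<eta>\<^sub>1 \<eta>\<^sub>2 \<eta>\<^sub>3 b" and y: "0 \<le> y" and w: "decreases_to_zero w"
  shows "decreases_to_zero (\<lambda>n. b (w n) y)"
proof -
  have bil: "bilinear b" and mono: "\<And>x x' y y'. 0 \<le> x \<Longrightarrow> x \<le> x' \<Longrightarrow> 0 \<le> y \<Longrightarrow> y \<le> y' \<Longrightarrow> b x y \<le> b x' y'"
    using prod unfolding riesz_product_def by blast+
  have w0: "0 \<le> w n" and dec: "m \<le> n \<Longrightarrow> w n \<le> w m" for m n
    using w by (auto simp: decreases_to_zero_iff decseq_def)
  have "is_sup (range (\<lambda>n. w 0 - w n)) (w 0)"
    unfolding is_sup_iff
  proof (intro conjI allI impI ballI)
    fix u assume "\<forall>x\<in>range (\<lambda>n. w 0 - w n). x \<le> u"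
    then have "\<forall>n. w 0 - u \<le> w n" by (simp add: algebra_simps)
    then show "w 0 \<le> u" using w by (fastforce simp: decreases_to_zero_iff)
  qed (use w0 in auto)
  then have sup: "is_sup (range (\<lambda>n. b (w 0 - w n) y)) (b (w 0) y)"
    using dec by (intro riesz_product_sup[OF prod _ y]) auto
  show ?thesis
    unfolding decreases_to_zero_iff
  proof (intro conjI allI impI)
    show "decseq (\<lambda>n. b (w n) y)" using w0 dec y by (auto simp: decseq_def intro!: mono)
    show "0 \<le> b (w n) y" for n
      using mono[of 0 "w n" y y] w0 y by (simp add: bilinear_lzero[OF bil])
    fix u assume u: "\<forall>n. u \<le> b (w n) y"
    have "b (w 0) y \<le> b (w 0) y - u"
      using u by (intro is_sup_least[OF sup]) (simp add: bilinear_lsub[OF bil])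
    then show "u \<le> 0" by simp
  qed
qed

lemma riemann_sum_diff_le:
  assumes prod: "riesz_product (conv1 S) (conv2 S) (conv3 S) (prd S)"
    and \<mu>: "\<And>i. i \<in> fam S A \<gamma> \<Longrightarrow> 0 \<le> \<mu> (piece S A \<gamma> i)"
    and M: "(\<Sum>i\<in>fam S A \<gamma>. \<mu> (piece S A \<gamma> i)) \<le> M"
    and s: "0 \<le> s" "\<And>i. i \<in> fam S A \<gamma> \<Longrightarrow> \<bar>f (tag S A \<gamma> i) - g (tag S A \<gamma> i)\<bar> \<le> s"
  shows "\<bar>riemann_sum S \<mu> f A \<gamma> - riemann_sum S \<mu> g A \<gamma>\<bar> \<le> prd S s M"
proof -
  have bil: "bilinear (prd S)" and mono: "\<And>x x' y y'. 0 \<le> x \<Longrightarrow> x \<le> x' \<Longrightarrow> 0 \<le> y \<Longrightarrow> y \<le> y' \<Longrightarrow> prd S x y \<le> prd S x' y'"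
    using prod unfolding riesz_product_def by blast+
  have lin: "linear (prd S s)" using bil by (simp add: bilinear_def)
  let ?f = "\<lambda>i. f (tag S A \<gamma> i)" and ?g = "\<lambda>i. g (tag S A \<gamma> i)" and ?m = "\<lambda>i. \<mu> (piece S A \<gamma> i)"
  have "\<bar>riemann_sum S \<mu> f A \<gamma> - riemann_sum S \<mu> g A \<gamma>\<bar> = \<bar>\<Sum>i\<in>fam S A \<gamma>. prd S (?f i - ?g i) (?m i)\<bar>"
    by (simp add: riemann_sum_def sum_subtractf bilinear_lsub[OF bil])
  also have "\<dots> \<le> (\<Sum>i\<in>fam S A \<gamma>. \<bar>prd S (?f i - ?g i) (?m i)\<bar>)" by (rule sum_abs)
  also have "\<dots> \<le> (\<Sum>i\<in>fam S A \<gamma>. prd S s (?m i))"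
  proof (rule sum_mono)
    fix i assume i: "i \<in> fam S A \<gamma>"
    have "\<bar>prd S (?f i - ?g i) (?m i)\<bar> \<le> prd S \<bar>?f i - ?g i\<bar> (?m i)"
      using riesz_product_abs_le[OF prod \<mu>[OF i]] .
    also have "\<dots> \<le> prd S s (?m i)" by (intro mono s \<mu> i) auto
    finally show "\<bar>prd S (?f i - ?g i) (?m i)\<bar> \<le> prd S s (?m i)" .
  qed
  also have "\<dots> = prd S s (\<Sum>i\<in>fam S A \<gamma>. ?m i)" by (simp add: linear_sum[OF lin])
  also have "\<dots> \<le> prd S s M" by (intro mono s M sum_nonneg \<mu>) auto
  finally show ?thesis .
qed

text \<open>The sum is the measure of the union of the pieces, and the complement of this union has
  nonnegative measure. The bound \<open>\<mu>(\<Omega>)\<close> depends neither on \<open>\<gamma>\<close> nor on \<open>A\<close>, so one regulator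
  serves for all sets.\<close>

lemma partition_mass_le:
  fixes S :: "('w, 'i, 'k, 'x::archimedean_riesz_space, 'y::archimedean_riesz_space,
      'z::archimedean_riesz_space) integration_structure"
  assumes S: "po_integration_structure S"
    and "sigma_algebra (Om S) (Hsets S)"
    and nonneg: "\<And>A. A \<in> Hsets S \<Longrightarrow> 0 \<le> \<mu> A"
    and add: "additive (Hsets S) \<mu>"
    and nets: "nets_additive_for S \<mu>"
    and A: "A \<in> Hsets S" "\<gamma> \<in> elems (\<Gamma> S A)"
  shows "(\<Sum>i\<in>fam S A \<gamma>. \<mu> (piece S A \<gamma> i)) \<le> \<mu> (Om S)"
proof -
  interpret sigma_algebra "Om S" "Hsets S" by fact
  let ?U = "\<Union>i\<in>fam S A \<gamma>. piece S A \<gamma> i"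
  have "?U \<in> Hsets S"
    using S A unfolding po_integration_structure_def by (intro finite_UN) auto
  moreover have "Om S = ?U \<union> (Om S - ?U)" using \<open>?U \<in> Hsets S\<close> sets_into_space by blast
  ultimately have "\<mu> (Om S) = \<mu> ?U + \<mu> (Om S - ?U)" "0 \<le> \<mu> (Om S - ?U)"
    using add nonneg by (metis Diff_disjoint additiveD compl_sets, blast)
  then show ?thesis using nets A by (simp add: nets_additive_for_def)
qed

section \<open>The convergence theorem\<close>

theorem theorem4p11:
  fixes S :: "('w, 'i, 'k, 'x::archimedean_riesz_space, 'y::archimedean_riesz_space,
      'z::archimedean_riesz_space) integration_structure"
    and \<mu> :: "'w set \<Rightarrow> 'y"
    and f :: "nat \<Rightarrow> 'w \<Rightarrow> 'x"
    and f\<^sub>0 :: "'w \<Rightarrow> 'x"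
  assumes "po_integration_structure S"
    and "sigma_algebra (Om S) (Hsets S)"
    and "conv3 S = D_convergence"
    and "sigma_dedekind_complete TYPE('z)"
    and "weakly_sigma_distributive TYPE('z)"
    and "\<And>A. A \<in> Hsets S \<Longrightarrow> 0 \<le> \<mu> A"
    and "additive (Hsets S) \<mu>"
    and "nets_additive_for S \<mu>"
    and "\<And>n. net_riemann_integrable S \<mu> (f n)"
    and "\<And>n. henstock_property S \<mu> (f n)"
    and "uniformly_regulated_integrals S \<mu> f \<or>
      (\<exists>z. \<forall>A\<in>Hsets S. \<forall>\<gamma>\<in>elems (\<Gamma> S A). \<forall>n.
        \<bar>net_integral S \<mu> (f n) A - riemann_sum S \<mu> (f n) A \<gamma>\<bar> \<le> z)"
    and "uniformly_approximable_integrals S \<mu> f"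
    and "converges_with_common_regulator (Om S) f f\<^sub>0"
    and "\<exists>h. (\<exists>x. \<forall>\<omega>\<in>Om S. \<bar>h \<omega>\<bar> \<le> x) \<and> (\<forall>n. \<forall>\<omega>\<in>Om S. \<bar>f n \<omega>\<bar> \<le> h \<omega>)"
  shows "net_riemann_integrable S \<mu> f\<^sub>0 \<and>
    (\<forall>A\<in>Hsets S. o_limit (\<lambda>n. net_integral S \<mu> (f n) A) (net_integral S \<mu> f\<^sub>0 A))"
proof -
  interpret sigma_algebra "Om S" "Hsets S" by fact
  have prod: "riesz_product (conv1 S) (conv2 S) (conv3 S) (prd S)"
    and haus: "hausdorff_convergence (conv3 S)"
    using assms(1) by (auto simp: po_integration_structure_def riesz_convergence_def)
  let ?M = "\<mu> (Om S)"
  have M: "0 \<le> ?M" using assms(6) top by blast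
  obtain a where a: "D_sequence a"
    and a_conv: "\<And>\<phi>. \<exists>s. is_sup (range (\<lambda>i. a i (\<phi> i))) s \<and>
        (\<forall>\<omega>\<in>Om S. \<exists>p. \<forall>n\<ge>p. \<bar>f n \<omega> - f\<^sub>0 \<omega>\<bar> \<le> s)"
    using assms(13) unfolding converges_with_common_regulator_def by blast
  obtain b where b: "D_sequence b"
    and b_conv: "\<And>\<phi>. \<exists>s. is_sup (range (\<lambda>i. b i (\<phi> i))) s \<and>
        (\<forall>A\<in>Hsets S. \<exists>\<gamma>0\<in>elems (\<Gamma> S A). \<forall>\<gamma>\<in>tail (\<Gamma> S A) \<gamma>0. \<forall>n.
          \<bar>net_integral S \<mu> (f n) A - riemann_sum S \<mu> (f n) A \<gamma>\<bar> \<le> s)"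
    using assms(12) unfolding uniformly_approximable_integrals_def by blast
  have aM: "D_sequence (\<lambda>i j. prd S (a i j) ?M)"
    using a decreases_to_zero_product[OF prod M] by (simp add: D_sequence_def)
  have key: "\<exists>l. has_net_integral S \<mu> f\<^sub>0 A l \<and> o_limit (\<lambda>n. net_integral S \<mu> (f n) A) l"
    if A: "A \<in> Hsets S" for A
  proof -
    have D: "directed_set (\<Gamma> S A)"
      using assms(1) A by (simp add: po_integration_structure_def)
    have pointwise: "\<exists>s. is_sup (range (\<lambda>i. prd S (a i (\<phi> i)) ?M)) s \<and>
      (\<forall>\<gamma>\<in>elems (\<Gamma> S A). \<exists>p. \<forall>n\<ge>p. \<bar>riemann_sum S \<mu> (f n) A \<gamma> - riemann_sum S \<mu> f\<^sub>0 A \<gamma>\<bar> \<le> s)" for \<phi>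
    proof -
      obtain s where s: "is_sup (range (\<lambda>i. a i (\<phi> i))) s"
        "\<And>\<omega>. \<omega> \<in> Om S \<Longrightarrow> \<exists>p. \<forall>n\<ge>p. \<bar>f n \<omega> - f\<^sub>0 \<omega>\<bar> \<le> s"
        using a_conv by blast
      have a_nonneg: "\<And>i. 0 \<le> a i (\<phi> i)" using a by (simp add: D_sequence_def decreases_to_zero_iff)
      have "is_sup (range (\<lambda>i. prd S (a i (\<phi> i)) ?M)) (prd S s ?M)"
        by (rule riesz_product_sup[OF prod a_nonneg M s(1)])
      moreover have "\<exists>p. \<forall>n\<ge>p. \<bar>riemann_sum S \<mu> (f n) A \<gamma> - riemann_sum S \<mu> f\<^sub>0 A \<gamma>\<bar> \<le> prd S s ?M"
        if \<gamma>: "\<gamma> \<in> elems (\<Gamma> S A)" for \<gamma>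
      proof -
        have fin: "finite (fam S A \<gamma>)"
          and mem: "\<And>i. i \<in> fam S A \<gamma> \<Longrightarrow> piece S A \<gamma> i \<in> Hsets S \<and> tag S A \<gamma> i \<in> Om S"
          using assms(1) A \<gamma> unfolding po_integration_structure_def by blast+
        have "\<forall>\<^sub>F n in sequentially. \<forall>i\<in>fam S A \<gamma>. \<bar>f n (tag S A \<gamma> i) - f\<^sub>0 (tag S A \<gamma> i)\<bar> \<le> s"
          using s(2) mem fin by (intro eventually_ball_finite) (auto simp: eventually_sequentially)
        then obtain p where p: "\<And>n i. n \<ge> p \<Longrightarrow> i \<in> fam S A \<gamma> \<Longrightarrow>
            \<bar>f n (tag S A \<gamma> i) - f\<^sub>0 (tag S A \<gamma> i)\<bar> \<le> s"
          unfolding eventually_sequentially by blast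
        have "\<bar>riemann_sum S \<mu> (f n) A \<gamma> - riemann_sum S \<mu> f\<^sub>0 A \<gamma>\<bar> \<le> prd S s ?M" if "n \<ge> p" for n
        proof (rule riemann_sum_diff_le[OF prod])
          show "(\<Sum>i\<in>fam S A \<gamma>. \<mu> (piece S A \<gamma> i)) \<le> ?M"
            by (rule partition_mass_le[OF assms(1,2,6,7,8) A \<gamma>])
          show "0 \<le> s" by (rule D_sequence_sup_nonneg[OF a s(1)])
        qed (use mem assms(6) p[OF that] in auto)
        then show ?thesis by blast
      qed
      ultimately show ?thesis by blast
    qed
    have uniform: "\<exists>s. is_sup (range (\<lambda>i. b i (\<phi> i))) s \<and>
      (\<exists>\<gamma>0\<in>elems (\<Gamma> S A). \<forall>\<gamma>\<in>tail (\<Gamma> S A) \<gamma>0. \<forall>n.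
          \<bar>net_integral S \<mu> (f n) A - riemann_sum S \<mu> (f n) A \<gamma>\<bar> \<le> s)" for \<phi>
      using b_conv[of \<phi>] A by blast
    show ?thesis
      using moore_osgood_regulated[OF assms(4,5) D aM pointwise b uniform]
      unfolding has_net_integral_def assms(3) by blast
  qed
  have "net_integral S \<mu> f\<^sub>0 A = l" if "has_net_integral S \<mu> f\<^sub>0 A l" for A l
    using that haus unfolding net_integral_def hausdorff_convergence_def has_net_integral_def
    by (intro the_equality) blast+
  then show ?thesis
    using key unfolding net_riemann_integrable_def net_integrable_on_def by metis
qed

end
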